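(* Let $\mathcal{A} = \langle a_1, a_2, \ldots, a_m\rangle$ be any data stream of $m$ elements with each $a_i \in [n] = \{1,\ldots,n\}$, and let $\mathsf{F_0}(\mathcal{A}) = |\{a_1, \ldots, a_m\}|$ denote the number of distinct elements in $\mathcal{A}$. For any $0 < \varepsilon, \delta < 1$, the algorithm $\mathsf{F_0\text{-}Estimator}$ (described in the context) run on $\mathcal{A}, \varepsilon, \delta$ outputs an $(\varepsilon,\delta)$-approximation of $\mathsf{F_0}(\mathcal{A})$; that is, its output $c$ satisfies $$\Pr\big[(1-\varepsilon)\,\mathsf{F_0}(\mathcal{A}) \le c \le (1+\varepsilon)\,\mathsf{F_0}(\mathcal{A})\big] \ge 1-\delta,$$ where an output of $\bot$ counts as not lying in this interval. Moreover, the algorithm uses $O\!\left(\frac{1}{\varepsilon^2}\cdot \log n \cdot \left(\log m + \log \frac{1}{\delta}\right)\right)$ bits of space in the worst case.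
   Context: Throughout, $\log$ denotes $\log_2$. The algorithm $\mathsf{F_0\text{-}Estimator}$ takes as input the stream $\mathcal{A} = \langle a_1,\ldots,a_m\rangle$ and parameters $\varepsilon,\delta$, and proceeds as follows, using fresh independent random coin flips at every random step. Initialize $p \gets 1$, $\mathcal{X} \gets \emptyset$, and $\mathsf{thresh} \gets \lceil \frac{12}{\varepsilon^2}\log(\frac{8m}{\delta})\rceil$. For $i = 1$ to $m$: (1) set $\mathcal{X} \gets \mathcal{X} \setminus \{a_i\}$; (2) with probability $p$, set $\mathcal{X} \gets \mathcal{X} \cup \{a_i\}$; (3) if $|\mathcal{X}| = \mathsf{thresh}$, then: throw away (remove from $\mathcal{X}$) each element of $\mathcal{X}$ independently with probability $\frac12$; set $p \gets p/2$; and if still $|\mathcal{X}| = \mathsf{thresh}$, output $\bot$ and halt. After the loop ends, output $\frac{|\mathcal{X}|}{p}$. Space is measured in bits, with each stored element of $[n]$ requiring $\lceil \log n\rceil$ bits.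
   Formalization: The space bound is stated for n ≥ 2 and m/δ ≥ 2 only: for n = 1 the bound is 0, for m = 1 and δ near 1 it tends to 0, and for m = 0 log m is undefined, so no single constant would work there. *)

theory Defs
  imports "HOL-Probability.Probability" "HOL-Library.Log_Nat"
begin

definition F0 :: "nat list \<Rightarrow> nat" where
  "F0 A = card (set A)"

definition F0_thresh :: "nat \<Rightarrow> real \<Rightarrow> real \<Rightarrow> nat" where
  "F0_thresh m \<epsilon> \<delta> = nat \<lceil>12 / \<epsilon>\<^sup>2 * log 2 (8 * real m / \<delta>)\<rceil>"

text \<open>
  The loop of the algorithm on the remaining stream, from the values \<open>X\<close> and \<open>p\<close> of its two
  mutable variables. The result is the output (\<open>None\<close> for the failure symbol) together
  with the set \<open>V\<close> of all pairs \<open>(X, p)\<close> held in memory in the course of this execution, recorded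
  after each of the three steps of every iteration; in step (3) also when the execution halts.
  The set \<open>V\<close> is only an observation, used to measure space, and does not influence the output.
\<close>

fun F0_loop ::
  "nat \<Rightarrow> nat list \<Rightarrow> nat set \<Rightarrow> real \<Rightarrow> (nat set \<times> real) set \<Rightarrow> (real option \<times> (nat set \<times> real) set) pmf"
where
  "F0_loop thresh [] X p V = return_pmf (Some (real (card X) / p), V)"
| "F0_loop thresh (a # as) X p V =
     do {
       let X1 = X - {a};
       coin \<leftarrow> bernoulli_pmf p;
       let X2 = (if coin then X1 \<union> {a} else X1);
       let V2 = V \<union> {(X1, p), (X2, p)};
       if card X2 = thresh then
         do {
           keep \<leftarrow> Pi_pmf X2 False (\<lambda>_. bernoulli_pmf (1 / 2));
           let X3 = {x \<in> X2. keep x};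
           let p3 = p / 2;
           let V3 = V2 \<union> {(X3, p3)};
           if card X3 = thresh then return_pmf (None, V3)
           else F0_loop thresh as X3 p3 V3
         }
       else F0_loop thresh as X2 p V2
     }"

definition F0_execution ::
  "nat list \<Rightarrow> real \<Rightarrow> real \<Rightarrow> (real option \<times> (nat set \<times> real) set) pmf" where
  "F0_execution A \<epsilon> \<delta> = F0_loop (F0_thresh (length A) \<epsilon> \<delta>) A {} 1 {({}, 1)}"

definition F0_Estimator :: "nat list \<Rightarrow> real \<Rightarrow> real \<Rightarrow> real option pmf" where
  "F0_Estimator A \<epsilon> \<delta> = map_pmf fst (F0_execution A \<epsilon> \<delta>)"

definition is_approximation :: "real \<Rightarrow> real \<Rightarrow> real option pmf \<Rightarrow> real \<Rightarrow> bool" where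
  "is_approximation \<epsilon> \<delta> D F \<longleftrightarrow>
     measure_pmf.prob D {Some c | c. (1 - \<epsilon>) * F \<le> c \<and> c \<le> (1 + \<epsilon>) * F} \<ge> 1 - \<delta>"

text \<open>
  Number of bits occupied by the variables of the algorithm. Elements of \<open>{1..n}\<close>, namely those
  of \<open>X\<close> and the current stream element, take \<open>\<lceil>log 2 n\<rceil>\<close> bits each. Since \<open>p\<close> is
  always \<open>1 / 2 ^ k\<close> for a natural number \<open>k\<close>, it is stored by writing \<open>k\<close> in binary. The threshold
  \<open>t\<close> and the loop index (at most \<open>m\<close>) are stored in binary as well; \<open>floorlog 2 k\<close> is the length
  of the binary representation of \<open>k\<close>.
\<close>

definition space_bits :: "nat \<Rightarrow> nat \<Rightarrow> nat \<Rightarrow> nat set \<Rightarrow> real \<Rightarrow> nat" where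
  "space_bits n m t X p =
     (card X + 1) * nat \<lceil>log 2 (real n)\<rceil>
     + floorlog 2 (nat \<lfloor>log 2 (1 / p)\<rfloor>) + floorlog 2 t + floorlog 2 m"

definition worst_case_space_le :: "nat \<Rightarrow> nat list \<Rightarrow> real \<Rightarrow> real \<Rightarrow> real \<Rightarrow> bool" where
  "worst_case_space_le n A \<epsilon> \<delta> B \<longleftrightarrow>
     (\<forall>(c, V) \<in> set_pmf (F0_execution A \<epsilon> \<delta>). \<forall>(X, p) \<in> V.
        real (space_bits n (length A) (F0_thresh (length A) \<epsilon> \<delta>) X p) \<le> B)"

end

(*
  Call l the level of the loop when p = 1/2^l. Halving commutes with the processing of stream
  elements, so a sample kept at the fixed level k from the start and never halved (the ideal sample)
  is a set in which each distinct element occurs independently with probability 1/2^k. If the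
  algorithm ends at level k without failing, its sample can be coupled to the ideal sample at level
  k. Instead of an explicit coupling, an induction on the stream bounds the probability of a bad
  output by a sum of probabilities about ideal samples, in which the level k is summed over 0..K.

  Let K be the least level with 2 F0 <= thresh * 2^K. An ideal sample at level K reaches the threshold
  with probability at most exp(-thresh/8), for each of the m prefixes of the stream. At the levels
  1 <= k <= K the expected sample size is at least thresh * 2^(K-k) / 4, so by the Chernoff bound the
  estimates are wrong with probabilities that sum up geometrically, and level 0 is exact. With
  x = delta/(8m), all these contributions together are at most m x + m x + 3 x <= delta.
*)

theory Submission imports Defs begin

section \<open>Independent thinning of a set and the arrival of a stream element\<close>

definition subsample :: "real \<Rightarrow> 'a set \<Rightarrow> 'a set pmf" where
  "subsample q X = map_pmf (\<lambda>keep. {x \<in> X. keep x}) (Pi_pmf X False (\<lambda>_. bernoulli_pmf q))"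

text \<open>Steps (1) and (2) of an iteration. Whether \<open>a\<close> was in \<open>X\<close>
  before has no influence on the result.\<close>

definition refresh :: "real \<Rightarrow> 'a set \<Rightarrow> 'a \<Rightarrow> 'a set pmf" where
  "refresh q X a = map_pmf (\<lambda>coin. if coin then insert a (X - {a}) else X - {a}) (bernoulli_pmf q)"

fun refresh_list :: "real \<Rightarrow> 'a set \<Rightarrow> 'a list \<Rightarrow> 'a set pmf" where
  "refresh_list q X [] = return_pmf X"
| "refresh_list q X (a # as) = bind_pmf (refresh q X a) (\<lambda>Y. refresh_list q Y as)"

lemma subsample_empty [simp]: "subsample q {} = return_pmf {}"
  by (simp add: subsample_def)

lemma set_pmf_subsample: "Y \<in> set_pmf (subsample q X) \<Longrightarrow> Y \<subseteq> X"
  by (auto simp: subsample_def)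

lemma set_pmf_refresh: "Y \<in> set_pmf (refresh q X a) \<Longrightarrow> Y \<subseteq> insert a X"
  by (auto simp: refresh_def split: if_splits)

text \<open>The coin of \<open>x\<close> is independent of the coins of \<open>X\<close> and may be
  tossed first.\<close>

lemma subsample_insert:
  assumes "finite X" "x \<notin> X"
  shows "subsample q (insert x X) =
    bind_pmf (bernoulli_pmf q) (\<lambda>c. map_pmf (\<lambda>Y. if c then insert x Y else Y) (subsample q X))"
proof -
  have eq: "{y \<in> insert x X. (f(x := c)) y} =
      (if c then insert x {y \<in> X. f y} else {y \<in> X. f y})" for f c
    using assms by auto
  show ?thesis
    unfolding subsample_def Pi_pmf_insert'[OF assms] map_bind_pmf bind_map_pmf map_return_pmf eq
    by (simp add: map_pmf_def bind_assoc_pmf bind_return_pmf)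
qed

lemma subsample_remove:
  assumes "finite X"
  shows "map_pmf (\<lambda>Y. Y - {a}) (subsample q X) = subsample q (X - {a})"
proof -
  have id: "map_pmf (\<lambda>Y. Y - {a}) (subsample q Z) = subsample q Z" if "a \<notin> Z" for Z
  proof -
    have "map_pmf (\<lambda>Y. Y - {a}) (subsample q Z) = map_pmf id (subsample q Z)"
      using that by (intro map_pmf_cong) (auto dest: set_pmf_subsample)
    then show ?thesis by (simp add: map_pmf_id)
  qed
  show ?thesis
  proof (cases "a \<in> X")
    case True
    have "(if c then insert a Y else Y) - {a} = Y - {a}" for c and Y :: "'a set" by auto
    then have "map_pmf (\<lambda>Y. Y - {a}) (subsample q (insert a (X - {a}))) = subsample q (X - {a})"
      using assms by (subst subsample_insert) (auto simp: map_bind_pmf pmf.map_comp comp_def id)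
    then show ?thesis using True by (simp add: insert_absorb)
  qed (use id in auto)
qed

text \<open>Splits the coin of a deeper level into the coin tossed when an element arrives and the
  one tossed when the set is thinned later.\<close>

lemma bernoulli_mult:
  assumes "q \<in> {0..1}" "r \<in> {0..1}"
  shows "bernoulli_pmf (q * r) =
    bind_pmf (bernoulli_pmf q) (\<lambda>c. if c then bernoulli_pmf r else return_pmf False)"
proof (rule pmf_eqI)
  fix b
  have "q * r \<in> {0..1}" using assms by (auto intro: mult_le_one)
  then show "pmf (bernoulli_pmf (q * r)) b =
      pmf (bind_pmf (bernoulli_pmf q) (\<lambda>c. if c then bernoulli_pmf r else return_pmf False)) b"
    using assms by (cases b) (auto simp: pmf_bind algebra_simps)
qed

lemma refresh_alt:
  "refresh q X a = bind_pmf (bernoulli_pmf q)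
     (\<lambda>c. return_pmf (if c then insert a (X - {a}) else X - {a}))"
  by (simp add: refresh_def map_pmf_def)

text \<open>A refresh overrides the earlier decision about \<open>a\<close>, so only the thinned
  rest and a fresh coin remain. Drawing the coin first gives a normal form for the commutation
  below.\<close>

lemma subsample_then_refresh:
  assumes "finite X"
  shows "bind_pmf (subsample r X) (\<lambda>Y. refresh q Y a) =
    bind_pmf (bernoulli_pmf q)
      (\<lambda>c. map_pmf (\<lambda>Y. if c then insert a Y else Y) (subsample r (X - {a})))"
  unfolding subsample_remove[OF assms, symmetric] refresh_alt
  by (subst bind_commute_pmf) (simp add: map_pmf_def bind_assoc_pmf bind_return_pmf)

text \<open>The fresh coin of \<open>a\<close> replaces any older one, so the set remains an
  independent sample, now of a set that contains \<open>a\<close>.\<close>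

lemma subsample_refresh:
  assumes "finite X"
  shows "bind_pmf (subsample q X) (\<lambda>Y. refresh q Y a) = subsample q (insert a X)"
proof -
  have "subsample q (insert a (X - {a})) = bind_pmf (subsample q X) (\<lambda>Y. refresh q Y a)"
    using assms by (subst subsample_insert) (auto simp: subsample_then_refresh)
  then show ?thesis by simp
qed

text \<open>The commutation behind the whole argument: \<open>a\<close> survives its arrival and the
  later thinning with probability \<open>q * r\<close>, and every other element meets only the
  thinning coin.\<close>

lemma refresh_subsample:
  assumes "finite X" "q \<in> {0..1}" "r \<in> {0..1}"
  shows "bind_pmf (refresh q X a) (subsample r) =
    bind_pmf (subsample r X) (\<lambda>Y. refresh (q * r) Y a)"
proof -
  have "subsample r (if c then insert a (X - {a}) else X - {a}) =
     bind_pmf (if c then bernoulli_pmf r else return_pmf False)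
      (\<lambda>c. map_pmf (\<lambda>Y. if c then insert a Y else Y) (subsample r (X - {a})))" for c
    using assms by (auto simp: subsample_insert bind_return_pmf simp del: insert_Diff_single)
  then show ?thesis
    unfolding subsample_then_refresh[OF assms(1)] bernoulli_mult[OF assms(2,3)]
    by (simp add: refresh_alt bind_assoc_pmf bind_return_pmf del: insert_Diff_single)
qed

text \<open>By \<open>subsample_refresh\<close>, inserting an element is a refresh, so the induction
  step is an instance of \<open>refresh_subsample\<close>.\<close>

lemma subsample_subsample:
  assumes "finite X" "q \<in> {0..1}" "r \<in> {0..1}"
  shows "bind_pmf (subsample q X) (subsample r) = subsample (q * r) X"
  using assms(1)
proof (induction X)
  case (insert x X)
  have fin: "finite Y" if "Y \<in> set_pmf (subsample q X)" for Y
    using set_pmf_subsample[OF that] insert.hyps finite_subset by blast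
  have "bind_pmf (subsample q (insert x X)) (subsample r) =
      bind_pmf (subsample q X) (\<lambda>Y. bind_pmf (subsample r Y) (\<lambda>Z. refresh (q * r) Z x))"
    unfolding subsample_refresh[OF insert.hyps(1), symmetric] bind_assoc_pmf
    by (intro bind_pmf_cong refl refresh_subsample fin assms)
  also have "\<dots> = subsample (q * r) (insert x X)"
    using insert by (simp add: subsample_refresh[symmetric] flip: bind_assoc_pmf)
  finally show ?case .
qed (simp add: bind_return_pmf)

lemma subsample_refresh_list:
  assumes "finite X"
  shows "bind_pmf (subsample q X) (\<lambda>Y. refresh_list q Y as) = subsample q (X \<union> set as)"
  using assms
proof (induction as arbitrary: X)
  case (Cons a as)
  have "bind_pmf (subsample q X) (\<lambda>Y. refresh_list q Y (a # as)) =
     bind_pmf (subsample q (insert a X)) (\<lambda>Y. refresh_list q Y as)"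
    using Cons.prems by (simp add: subsample_refresh[symmetric] bind_assoc_pmf)
  then show ?case using Cons by simp
qed (simp add: bind_return_pmf')

lemma card_subsample:
  assumes "finite X" "q \<in> {0..1}"
  shows "map_pmf card (subsample q X) = binomial_pmf (card X) q"
  unfolding subsample_def using assms
  by (simp add: binomial_pmf_altdef'[of X _ q False] pmf.map_comp comp_def)

lemma bernoulli_1: "bernoulli_pmf 1 = return_pmf True"
proof (rule pmf_eqI)
  fix b show "pmf (bernoulli_pmf 1) b = pmf (return_pmf True) b" by (cases b) auto
qed

lemma subsample_1 [simp]:
  assumes "finite X"
  shows "subsample 1 X = return_pmf X"
  using assms
  by induction (auto simp: subsample_insert bernoulli_1 bind_return_pmf)

section \<open>Ideal samples at a fixed level\<close>

text \<open>
  The sample at level \<open>k\<close> after the stream \<open>as\<close>, if the sample \<open>X\<close> at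
  level \<open>l\<close> is brought down to level \<open>k\<close> at once and never halved afterwards.
\<close>

definition ideal :: "nat \<Rightarrow> 'a set \<Rightarrow> nat \<Rightarrow> 'a list \<Rightarrow> 'a set pmf" where
  "ideal k X l as = bind_pmf (subsample ((1/2) ^ (k - l)) X) (\<lambda>Y. refresh_list ((1/2) ^ k) Y as)"

lemma half_power_01: "(1/2) ^ k \<in> {0..1::real}"
  by (simp add: power_le_one)

text \<open>Factor (1/2)^k as (1/2)^l times (1/2)^(k-l) and apply \<open>refresh_subsample\<close>:
  an arrival at the actual level \<open>l\<close> leads to the same ideal sample as an arrival at
  level \<open>k\<close>.\<close>

lemma ideal_Cons:
  assumes "finite X" "l \<le> k"
  shows "ideal k X l (a # as) = bind_pmf (refresh ((1/2)^l) X a) (\<lambda>Y. ideal k Y l as)"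
proof -
  have e: "(1/2)^k = (1/2)^l * ((1/2)^(k-l) :: real)"
    using assms by (simp flip: power_add)
  have "bind_pmf (refresh ((1/2)^l) X a) (\<lambda>Y. ideal k Y l as) =
    bind_pmf (bind_pmf (refresh ((1/2)^l) X a) (subsample ((1/2)^(k-l))))
      (\<lambda>Y. refresh_list ((1/2) ^ k) Y as)"
    by (simp add: ideal_def bind_assoc_pmf)
  also have "\<dots> = ideal k X l (a # as)"
    using assms half_power_01
    by (simp add: refresh_subsample ideal_def bind_assoc_pmf e[symmetric])
  finally show ?thesis ..
qed

text \<open>One halving is the first of the \<open>k - l\<close> halvings that the ideal sample
  performs at once.\<close>

lemma ideal_Suc:
  assumes "finite X" "Suc l \<le> k"
  shows "ideal k X l as = bind_pmf (subsample (1/2) X) (\<lambda>Y. ideal k Y (Suc l) as)"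
proof -
  have e: "(1/2)^(k-l) = (1/2) * ((1/2)^(k-Suc l) :: real)"
    using assms by (metis Suc_diff_le diff_Suc_Suc power_Suc)
  have "subsample ((1/2)^(k-l)) X = bind_pmf (subsample (1/2) X) (subsample ((1/2)^(k-Suc l)))"
    unfolding e using assms(1) half_power_01 by (subst subsample_subsample) auto
  then show ?thesis by (simp add: ideal_def bind_assoc_pmf)
qed

lemma ideal_empty: "ideal k {} l as = subsample ((1/2) ^ k) (set as)"
  using subsample_refresh_list[of "{}" "(1/2)^k" as] by (simp add: ideal_def)

lemma ideal_self: "finite X \<Longrightarrow> ideal k X k as = refresh_list ((1/2) ^ k) X as"
  by (simp add: ideal_def bind_return_pmf)

section \<open>Failure probability of the loop in terms of ideal samples\<close>

lemma F0_loop_Cons: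
  "F0_loop t (a # as) X p V = bind_pmf (refresh p X a) (\<lambda>X2.
     let V2 = V \<union> {(X - {a}, p), (X2, p)} in
     if card X2 = t then
       bind_pmf (subsample (1/2) X2) (\<lambda>X3.
         let V3 = V2 \<union> {(X3, p / 2)} in
         if card X3 = t then return_pmf (None, V3) else F0_loop t as X3 (p / 2) V3)
     else F0_loop t as X2 p V2)"
  by (simp add: refresh_def subsample_def bind_map_pmf Let_def cong: if_cong)

text \<open>
  The three summands pay for a halving step that removes nothing, for the ideal sample at level
  \<open>K\<close> reaching the threshold (the only way to get beyond level \<open>K\<close>), and for a
  wrong estimate at one of the levels up to \<open>K\<close>.
\<close>

definition failure_bound :: "nat \<Rightarrow> nat \<Rightarrow> real set \<Rightarrow> 'a set \<Rightarrow> nat \<Rightarrow> 'a list \<Rightarrow> ennreal" where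
  "failure_bound t K G X l as =
     of_nat (length as) * ennreal ((1/2) ^ t)
     + (\<Sum>j<length as. emeasure (ideal K X l (take (Suc j) as)) {Y. card Y = t})
     + (\<Sum>k=l..K. emeasure (ideal k X l as) {Y. real (card Y) * 2 ^ k \<notin> G})"

text \<open>By \<open>ideal_Cons\<close>, every probability about an ideal sample is an average over
  the refreshed set. The first two summands are the share of the first iteration.\<close>

lemma failure_bound_Cons:
  assumes "finite X" "l \<le> K"
  shows "failure_bound t K G X l (a # as) = ennreal ((1/2) ^ t)
    + emeasure (ideal K X l [a]) {Y. card Y = t}
    + (\<integral>\<^sup>+Y. failure_bound t K G Y l as \<partial>refresh ((1/2)^l) X a)"
proof -
  have "emeasure (ideal k X l (a # bs)) S =
      (\<integral>\<^sup>+Y. emeasure (ideal k Y l bs) S \<partial>refresh ((1/2)^l) X a)" if "l \<le> k" for k bs S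
    by (simp add: ideal_Cons[OF assms(1) that] emeasure_bind_pmf)
  then show ?thesis
    unfolding failure_bound_def
    using assms(2)
    by (simp add: sum.lessThan_Suc_shift nn_integral_add nn_integral_sum algebra_simps
        measure_pmf.emeasure_eq_1_AE distrib_right del: sum.lessThan_Suc)
qed

text \<open>A halving preserves the summands of the levels above \<open>l\<close> on average by
  \<open>ideal_Suc\<close>; the summand of level \<open>l\<close> is dropped.\<close>

lemma failure_bound_Suc:
  assumes "finite X" "l < K"
  shows "(\<integral>\<^sup>+Y. failure_bound t K G Y (Suc l) as \<partial>subsample (1/2) X) \<le> failure_bound t K G X l as"
proof -
  have "emeasure (ideal k X l bs) S =
      (\<integral>\<^sup>+Y. emeasure (ideal k Y (Suc l) bs) S \<partial>subsample (1/2) X)" if "Suc l \<le> k" for k bs S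
    by (simp add: ideal_Suc[OF assms(1) that] emeasure_bind_pmf)
  then have "(\<integral>\<^sup>+Y. failure_bound t K G Y (Suc l) as \<partial>subsample (1/2) X) =
     of_nat (length as) * ennreal ((1/2) ^ t)
     + (\<Sum>j<length as. emeasure (ideal K X l (take (Suc j) as)) {Y. card Y = t})
     + (\<Sum>k=Suc l..K. emeasure (ideal k X l as) {Y. real (card Y) * 2 ^ k \<notin> G})"
    unfolding failure_bound_def using assms(2)
    by (simp add: nn_integral_add nn_integral_sum)
  also have "\<dots> \<le> failure_bound t K G X l as"
    unfolding failure_bound_def
    by (intro add_left_mono sum_mono2) auto
  finally show ?thesis .
qed

lemma prob_subsample_all:
  assumes "finite Y" "card Y = t"
  shows "emeasure (subsample (1/2) Y) {Z. card Z = t} = ennreal ((1/2) ^ t)"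
proof -
  have "emeasure (subsample (1/2) Y) {Z. card Z = t} =
      emeasure (map_pmf card (subsample (1/2) Y)) {t}"
    by (simp add: vimage_def)
  also have "\<dots> = ennreal ((1/2) ^ t)"
    using assms by (simp add: card_subsample emeasure_pmf_single)
  finally show ?thesis .
qed

text \<open>Induction on the stream from an arbitrary state. Each iteration spends its share in
  \<open>failure_bound_Cons\<close>, and the rest is passed on to the induction hypothesis, averaged
  over the random choices.\<close>

lemma loop_failure:
  assumes "finite X" "l \<le> K" "0 < t"
  shows "emeasure (F0_loop t as X ((1/2)^l) V) {r. fst r \<notin> Some ` G} \<le> failure_bound t K G X l as"
  using assms
proof (induction as arbitrary: X l V)
  case Nil
  have "emeasure (F0_loop t [] X ((1/2)^l) V) {r. fst r \<notin> Some ` G} =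
      emeasure (ideal l X l []) {Y. real (card Y) * 2 ^ l \<notin> G}"
    using Nil by (auto simp: ideal_self power_one_over divide_simps indicator_def)
  also have "\<dots> \<le> failure_bound t K G X l []"
    unfolding failure_bound_def using Nil.prems
    by (auto intro!: member_le_sum[of l] simp: add_increasing)
  finally show ?case .
next
  case (Cons a as)
  let ?bad = "{r :: real option \<times> (nat set \<times> real) set. fst r \<notin> Some ` G}"
  let ?R = "refresh ((1/2)^l) X a"
  let ?e = "ennreal ((1/2) ^ t)"
  let ?V2 = "\<lambda>Y. V \<union> {(X - {a}, (1/2)^l), (Y, (1/2)^l)}"
  \<comment> \<open>\<open>f Y\<close> is the failure probability once steps (1) and (2) have
    produced \<open>Y\<close>.\<close>
  define f where "f = (\<lambda>Y. if card Y = t then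
      (\<integral>\<^sup>+Z. (if card Z = t then 1 else emeasure (F0_loop t as Z ((1/2)^l / 2)
          (?V2 Y \<union> {(Z, (1/2)^l / 2)})) ?bad) \<partial>subsample (1/2) Y)
      else emeasure (F0_loop t as Y ((1/2)^l) (?V2 Y)) ?bad)"
  have finR: "finite Y" if "Y \<in> set_pmf ?R" for Y
    using set_pmf_refresh[OF that] Cons.prems(1) finite_subset by blast
  have fe: "emeasure (F0_loop t (a # as) X ((1/2)^l) V) ?bad = (\<integral>\<^sup>+Y. f Y \<partial>?R)"
    unfolding F0_loop_Cons emeasure_bind_pmf f_def Let_def
    by (intro nn_integral_cong) (auto simp: emeasure_bind_pmf intro!: nn_integral_cong)
  have f_bound: "f Y \<le> ?e + indicator {Y. l = K \<and> card Y = t} Y + failure_bound t K G Y l as"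
    if Y: "Y \<in> set_pmf ?R" for Y
  proof (cases "card Y = t")
    case False
    then have "f Y \<le> failure_bound t K G Y l as"
      unfolding f_def using Cons.IH[OF finR[OF Y] Cons.prems(2,3)] by simp
    then show ?thesis by (simp add: add_increasing)
  next
    case True
    show ?thesis
    proof (cases "l = K")
      case True
      \<comment> \<open>A halving here would lead beyond level \<open>K\<close>, outside the
        induction hypothesis, so this event is charged with the trivial bound 1.\<close>
      have "f Y \<le> (\<integral>\<^sup>+Z. 1 \<partial>subsample (1/2) Y)"
        unfolding f_def if_P[OF \<open>card Y = t\<close>]
        by (intro nn_integral_mono) (simp add: measure_pmf.emeasure_le_1)
      also have "\<dots> = 1" by simp
      finally have "f Y \<le> 1" .
      then show ?thesis using True \<open>card Y = t\<close>
        by (simp add: add_increasing add_increasing2)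
    next
      case False
      then have l: "Suc l \<le> K" using Cons.prems by simp
      have step: "(if card Z = t then 1 else emeasure (F0_loop t as Z ((1/2)^l / 2)
          (?V2 Y \<union> {(Z, (1/2)^l / 2)})) ?bad)
           \<le> indicator {Z. card Z = t} Z + failure_bound t K G Z (Suc l) as"
        if "Z \<in> set_pmf (subsample (1/2) Y)" for Z
      proof -
        have "finite Z" using set_pmf_subsample[OF that] finR[OF Y] by (rule finite_subset)
        from Cons.IH[OF this l Cons.prems(3), of "?V2 Y \<union> {(Z, (1/2)^l / 2)}"]
        show ?thesis by (simp add: add_increasing2)
      qed
      have "f Y \<le> (\<integral>\<^sup>+Z. indicator {Z. card Z = t} Z + failure_bound t K G Z (Suc l) as \<partial>subsample (1/2) Y)"
        unfolding f_def if_P[OF True]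
        by (rule nn_integral_mono_AE, unfold AE_measure_pmf_iff, rule ballI, rule step)
      also have "\<dots> = ?e + (\<integral>\<^sup>+Z. failure_bound t K G Z (Suc l) as \<partial>subsample (1/2) Y)"
        using prob_subsample_all[OF finR[OF Y] True] by (simp add: nn_integral_add)
      also have "\<dots> \<le> ?e + failure_bound t K G Y l as"
        using failure_bound_Suc[OF finR[OF Y]] l by (intro add_left_mono) auto
      finally show ?thesis using False by simp
    qed
  qed
  have "(\<integral>\<^sup>+Y. f Y \<partial>?R) \<le>
     (\<integral>\<^sup>+Y. ?e + indicator {Y. l = K \<and> card Y = t} Y + failure_bound t K G Y l as \<partial>?R)"
    using f_bound by (intro nn_integral_mono_AE) (simp add: AE_measure_pmf_iff)
  also have "\<dots> = ?e + emeasure ?R {Y. l = K \<and> card Y = t}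
      + (\<integral>\<^sup>+Y. failure_bound t K G Y l as \<partial>?R)"
    by (simp add: nn_integral_add)
  \<comment> \<open>For \<open>l = K\<close> the ideal sample after \<open>[a]\<close> is the
    refreshed set itself; for \<open>l < K\<close> the event on the left is empty.\<close>
  also have "\<dots> \<le> failure_bound t K G X l (a # as)"
    unfolding failure_bound_Cons[OF Cons.prems(1,2)]
    using Cons.prems
    by (intro add_right_mono add_left_mono)
       (cases "l = K", auto simp: ideal_self bind_return_pmf')
  finally show ?case using fe by simp
qed

section \<open>Chernoff bounds for the sample size\<close>

text \<open>Markov's inequality for the moment generating function. As \<open>s\<close> may have
  either sign, it covers both tails.\<close>

lemma binomial_exponential_bound:
  fixes q s c :: real
  assumes q: "q \<in> {0..1}" and S: "\<And>k. k \<in> S \<Longrightarrow> c \<le> s * real k"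
  shows "measure_pmf.prob (binomial_pmf n q) S \<le> exp (real n * q * (exp s - 1) - c)"
proof -
  let ?B = "binomial_pmf n q"
  have int: "integrable ?B f" for f :: "nat \<Rightarrow> real"
    using q by auto
  have "measure_pmf.prob ?B S = measure_pmf.expectation ?B (indicator S)" by simp
  also have "\<dots> \<le> measure_pmf.expectation ?B (\<lambda>k. exp (s * real k - c))"
    using S by (intro integral_mono int) (auto simp: indicator_def)
  also have "\<dots> = (\<Sum>k\<le>n. exp (s * real k - c) * (real (n choose k) * q ^ k * (1 - q) ^ (n - k)))"
    using q by (subst expectation_binomial_pmf') (auto simp: algebra_simps)
  also have "\<dots> = exp (- c) * (\<Sum>k\<le>n. real (n choose k) * (q * exp s) ^ k * (1 - q) ^ (n - k))"
    unfolding sum_distrib_left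
    by (intro sum.cong refl)
       (simp add: exp_diff exp_minus power_mult_distrib exp_of_nat2_mult mult_ac field_simps)
  also have "\<dots> = exp (- c) * (q * exp s + (1 - q)) ^ n"
    by (subst binomial_ring) simp
  also have "\<dots> \<le> exp (- c) * exp (q * (exp s - 1)) ^ n"
  proof (intro mult_left_mono power_mono)
    have "1 + q * (exp s - 1) \<le> exp (q * (exp s - 1))" by (rule exp_ge_add_one_self)
    then show "q * exp s + (1 - q) \<le> exp (q * (exp s - 1))" by (simp add: algebra_simps)
  qed (use q in auto)
  also have "\<dots> = exp (real n * q * (exp s - 1) - c)"
    by (simp add: exp_of_nat_mult[symmetric] exp_add[symmetric] mult_ac)
  finally show ?thesis .
qed

lemma exp_le_quadratic:
  fixes s :: real
  assumes "s \<le> 1"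
  shows "exp s \<le> 1 + s + s\<^sup>2"
proof (cases "0 \<le> s")
  case True
  then show ?thesis using assms by (rule exp_bound)
next
  case False
  define u where "u = - s"
  have u: "0 \<le> u" using False by (simp add: u_def)
  \<comment> \<open>For negative \<open>s\<close> it suffices that \<open>1 - u + u\<^sup>2\<close>
    times the quadratic Taylor bound of \<open>exp u\<close> is at least 1.\<close>
  have "0 \<le> u\<^sup>2 / 2 + u ^ 3 / 2 + u ^ 4 / 2" using u by simp
  also have "\<dots> = (1 + u + u\<^sup>2 / 2) * (1 - u + u\<^sup>2) - 1"
    by (simp add: field_simps power2_eq_square power3_eq_cube power4_eq_xxxx)
  finally have "1 \<le> (1 + u + u\<^sup>2 / 2) * (1 - u + u\<^sup>2)" by simp
  moreover have "0 \<le> 1 - u + u\<^sup>2"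
    using zero_le_power2[of "u - 1/2"] by (simp add: power2_eq_square field_simps)
  ultimately have "1 \<le> exp u * (1 - u + u\<^sup>2)"
    using exp_lower_Taylor_quadratic[OF u] by (meson mult_right_mono order_trans)
  then show ?thesis by (simp add: u_def exp_minus field_simps)
qed

text \<open>The exponential bound with s = 1/2. The mean is at most t/2 and exp(1/2) - 1 at most
  3/4, so the exponent is at most 3t/8 - t/2 = -t/8.\<close>

lemma subsample_upper_tail:
  assumes "finite S" "q \<in> {0..1}" "2 * (real (card S) * q) \<le> real t"
  shows "measure_pmf.prob (subsample q S) {Y. card Y = t} \<le> exp (- real t / 8)"
proof -
  have "measure_pmf.prob (subsample q S) {Y. card Y = t} =
      measure_pmf.prob (map_pmf card (subsample q S)) {t}"
    by (simp add: vimage_def)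
  also have "\<dots> \<le> exp (real (card S) * q * (exp (1/2) - 1) - 1/2 * real t)"
    unfolding card_subsample[OF assms(1,2)]
    by (intro binomial_exponential_bound assms) auto
  also have "\<dots> \<le> exp (real t / 2 * (3/4) - 1/2 * real t)"
  proof -
    have "exp (1/2) - 1 \<le> (3/4 :: real)"
      using exp_le_quadratic[of "1/2"] by (simp add: power2_eq_square)
    then have "real (card S) * q * (exp (1/2) - 1) \<le> real t / 2 * (3/4)"
      using assms by (intro mult_mono) auto
    then show ?thesis by simp
  qed
  finally show ?thesis by simp
qed

text \<open>The exponential bound with s = \<epsilon>/2 above and s = -\<epsilon>/2 below. Both
  tails then have the same form, with exponent F q (s^2 - \<epsilon>^2/2) and s^2 =
  \<epsilon>^2/4.\<close>

lemma subsample_deviation: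
  fixes \<epsilon> :: real
  assumes "finite S" and q: "0 < q" "q \<le> 1" and eps: "0 < \<epsilon>" "\<epsilon> < 1"
  defines "F \<equiv> real (card S)"
  shows "measure_pmf.prob (subsample q S)
    {Y. real (card Y) / q \<notin> {(1 - \<epsilon>) * F..(1 + \<epsilon>) * F}} \<le> 2 * exp (- (\<epsilon>\<^sup>2 * (F * q) / 4))"
proof -
  let ?B = "binomial_pmf (card S) q"
  have q01: "q \<in> {0..1}" using q by simp
  have tail: "measure_pmf.prob ?B T \<le> exp (- (\<epsilon>\<^sup>2 * (F * q) / 4))"
    if s: "s\<^sup>2 = \<epsilon>\<^sup>2 / 4" "s \<le> 1"
      and T: "\<And>k. k \<in> T \<Longrightarrow> F * q * (s + \<epsilon>\<^sup>2 / 2) \<le> s * real k" for T s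
  proof -
    have "measure_pmf.prob ?B T \<le> exp (real (card S) * q * (exp s - 1) - F * q * (s + \<epsilon>\<^sup>2 / 2))"
      by (rule binomial_exponential_bound[OF q01 T])
    also have "\<dots> \<le> exp (F * q * (s + s\<^sup>2) - F * q * (s + \<epsilon>\<^sup>2 / 2))"
    proof -
      have "exp s - 1 \<le> s + s\<^sup>2" using exp_le_quadratic[OF s(2)] by simp
      then have "F * q * (exp s - 1) \<le> F * q * (s + s\<^sup>2)"
        using q by (intro mult_left_mono) (auto simp: F_def)
      then show ?thesis by (simp add: F_def)
    qed
    also have "\<dots> = exp (- (\<epsilon>\<^sup>2 * (F * q) / 4))"
      using s(1) by (simp add: algebra_simps)
    finally show ?thesis .
  qed
  have up: "measure_pmf.prob ?B {k. (1 + \<epsilon>) * F * q \<le> real k} \<le> exp (- (\<epsilon>\<^sup>2 * (F * q) / 4))"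
  proof (rule tail[of "\<epsilon> / 2"])
    fix k assume "k \<in> {k. (1 + \<epsilon>) * F * q \<le> real k}"
    then have "\<epsilon> / 2 * ((1 + \<epsilon>) * F * q) \<le> \<epsilon> / 2 * real k" using eps by (intro mult_left_mono) auto
    then show "F * q * (\<epsilon> / 2 + \<epsilon>\<^sup>2 / 2) \<le> \<epsilon> / 2 * real k"
      by (simp add: algebra_simps power2_eq_square)
  qed (use eps in \<open>auto simp: power2_eq_square\<close>)
  have low: "measure_pmf.prob ?B {k. real k \<le> (1 - \<epsilon>) * F * q} \<le> exp (- (\<epsilon>\<^sup>2 * (F * q) / 4))"
  proof (rule tail[of "- \<epsilon> / 2"])
    fix k assume "k \<in> {k. real k \<le> (1 - \<epsilon>) * F * q}"
    then have "\<epsilon> / 2 * real k \<le> \<epsilon> / 2 * ((1 - \<epsilon>) * F * q)" using eps by (intro mult_left_mono) auto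
    then show "F * q * (- \<epsilon> / 2 + \<epsilon>\<^sup>2 / 2) \<le> - \<epsilon> / 2 * real k"
      by (simp add: algebra_simps power2_eq_square)
  qed (use eps in \<open>auto simp: power2_eq_square\<close>)
  have "measure_pmf.prob (subsample q S) {Y. real (card Y) / q \<notin> {(1 - \<epsilon>) * F..(1 + \<epsilon>) * F}}
      = measure_pmf.prob ?B {k. real k / q \<notin> {(1 - \<epsilon>) * F..(1 + \<epsilon>) * F}}"
    unfolding card_subsample[OF assms(1) q01, symmetric] by (simp add: vimage_def)
  also have "\<dots> \<le> measure_pmf.prob ?B ({k. (1 + \<epsilon>) * F * q \<le> real k} \<union> {k. real k \<le> (1 - \<epsilon>) * F * q})"
    using q by (intro measure_pmf.finite_measure_mono) (auto simp: field_simps)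
  also have "\<dots> \<le> measure_pmf.prob ?B {k. (1 + \<epsilon>) * F * q \<le> real k}
      + measure_pmf.prob ?B {k. real k \<le> (1 - \<epsilon>) * F * q}"
    by (intro measure_Un_le) auto
  finally show ?thesis using up low by simp
qed

section \<open>Choice of the level \<open>K\<close> and summation of the error probabilities\<close>

lemma F0_estimate_failure:
  fixes \<epsilon> \<delta> :: real
  assumes "A \<noteq> []" and eps: "0 < \<epsilon>" "\<epsilon> < 1" and delta: "0 < \<delta>" "\<delta> < 1"
  defines "F \<equiv> real (F0 A)" and "t \<equiv> F0_thresh (length A) \<epsilon> \<delta>"
  shows "emeasure (F0_loop t A {} 1 V) {r. fst r \<notin> Some ` {(1 - \<epsilon>) * F..(1 + \<epsilon>) * F}} \<le> ennreal \<delta>"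
proof -
  define m where "m = length A"
  define x where "x = \<delta> / (8 * real m)"
  \<comment> \<open>Since 1/x = 8m/\<delta>, \<open>L\<close> is the logarithm in the
    threshold.\<close>
  define L where "L = log 2 (1 / x)"
  define G where "G = {(1 - \<epsilon>) * F..(1 + \<epsilon>) * F}"
  have m: "1 \<le> real m" using assms(1) by (cases A) (auto simp: m_def)
  have x: "0 < x" "x \<le> 1/8" using m delta by (auto simp: x_def field_simps)
  have L: "0 < L" using x by (simp add: L_def)
  have lnL: "ln (1 / x) \<le> 3/4 * L"
  proof -
    have "ln (1 / x) = L * ln 2" by (simp add: L_def log_def)
    also have "\<dots> \<le> L * (3/4)" using L ln2_le_25_over_36 by (intro mult_left_mono) auto
    finally show ?thesis by simp
  qed
  have "12 / \<epsilon>\<^sup>2 * L \<le> real t"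
    unfolding t_def F0_thresh_def L_def x_def m_def[symmetric] by (simp add: real_nat_ceiling_ge)
  then have epst: "12 * L \<le> \<epsilon>\<^sup>2 * real t" using eps by (simp add: field_simps)
  have "\<epsilon>\<^sup>2 * real t \<le> 1 * real t" using eps by (intro mult_right_mono) (auto simp: power_le_one)
  with epst have t: "12 * L \<le> real t" by simp
  with L have t0: "0 < t" by (cases t) auto
  have half_t: "(1/2) ^ t \<le> x"
  proof -
    have "(1/2) ^ t = 2 powr (- real t)"
      by (simp add: powr_minus powr_realpow power_one_over field_simps)
    also have "\<dots> \<le> 2 powr (- L)" using t L by (intro powr_mono) auto
    also have "\<dots> = x" using x by (simp add: L_def powr_minus)
    finally show ?thesis .
  qed
  have exp_t: "exp (- real t / 8) \<le> x"
  proof -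
    have "exp (- real t / 8) \<le> exp (- ln (1 / x))" using t L lnL by simp
    also have "\<dots> = x" using x by (simp add: ln_div)
    finally show ?thesis .
  qed
  \<comment> \<open>the first level at which the expected sample size is at most half the threshold\<close>
  define K where "K = (LEAST K. 2 * F \<le> real t * 2 ^ K)"
  have K: "2 * F \<le> real t * 2 ^ K"
    unfolding K_def
  proof (rule LeastI)
    \<comment> \<open>Some level satisfies the inequality: \<open>2 * F0 A\<close> does, because j <
      2^j and the threshold is positive.\<close>
    have "2 * F \<le> 1 * 2 ^ (2 * F0 A)"
      using of_nat_mono[OF less_imp_le[OF less_exp[of "2 * F0 A"]], where 'a = real] by (simp add: F_def)
    also have "\<dots> \<le> real t * 2 ^ (2 * F0 A)" using t0 by (intro mult_right_mono) auto
    finally show "2 * F \<le> real t * 2 ^ (2 * F0 A)" .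
  qed
  \<comment> \<open>By minimality of \<open>K\<close>, level \<open>K - 1\<close> violates its
    defining inequality, which bounds \<open>F\<close> from below. Level 0 is left out here; its
    sample is exact.\<close>
  have F_large: "real t * 2 ^ (K - 1) \<le> 2 * F" if "0 < K"
    using not_less_Least[of "K - 1" "\<lambda>K. 2 * F \<le> real t * 2 ^ K"] that
    unfolding K_def[symmetric] by simp
  have reach: "measure_pmf.prob (ideal K {} 0 (take (Suc j) A)) {Y. card Y = t} \<le> x" for j
  proof -
    have "real (card (set (take (Suc j) A))) \<le> F"
      unfolding F_def F0_def by (simp add: card_mono set_take_subset)
    then have "2 * (real (card (set (take (Suc j) A))) * (1/2) ^ K) \<le> real t"
      using K by (simp add: power_one_over field_simps)
    then have "measure_pmf.prob (ideal K {} 0 (take (Suc j) A)) {Y. card Y = t} \<le> exp (- real t / 8)"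
      unfolding ideal_empty by (intro subsample_upper_tail half_power_01) auto
    then show ?thesis using exp_t by simp
  qed
  have dev: "measure_pmf.prob (ideal k {} 0 A) {Y. real (card Y) * 2 ^ k \<notin> G} \<le> 2 * x ^ (Suc K - k)"
    if k: "1 \<le> k" "k \<le> K" for k
  proof -
    have "measure_pmf.prob (ideal k {} 0 A) {Y. real (card Y) * 2 ^ k \<notin> G}
        \<le> 2 * exp (- (\<epsilon>\<^sup>2 * (F * (1/2) ^ k) / 4))"
      using subsample_deviation[of "set A" "(1/2) ^ k" \<epsilon>] eps
      by (simp add: ideal_empty G_def F_def F0_def power_one_over power_le_one)
    also have "\<dots> \<le> 2 * exp (- (real (Suc K - k) * ln (1 / x)))"
    proof -
      have "real t * 2 ^ (K - 1) * (1/2) ^ k \<le> 2 * F * (1/2) ^ k"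
        using F_large k by (intro mult_right_mono) auto
      moreover have "real t * 2 ^ (K - 1) * (1/2) ^ k = real t * 2 ^ (K - k) / 2"
      proof -
        have "(2::real) ^ K = 2 ^ (K - k) * 2 ^ k" "(2::real) ^ K = 2 * 2 ^ (K - 1)"
          using k by (simp_all flip: power_add power_Suc)
        then show ?thesis by (simp add: power_one_over field_simps)
      qed
      ultimately have "real t * 2 ^ (K - k) / 4 \<le> F * (1/2) ^ k" by linarith
      then have "\<epsilon>\<^sup>2 * (real t * 2 ^ (K - k) / 4) \<le> \<epsilon>\<^sup>2 * (F * (1/2) ^ k)"
        by (intro mult_left_mono) auto
      moreover have "2 ^ (K - k) * (3/4 * L) \<le> \<epsilon>\<^sup>2 * (real t * 2 ^ (K - k) / 4) / 4"
      proof -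
        \<comment> \<open>One factor 1/4 comes from the expected sample size and one from the
          Chernoff exponent. They leave 12/16 = 3/4 of the constant in the threshold, the factor in
          \<open>lnL\<close>.\<close>
        have "2 ^ (K - k) * (3/4 * L) = 12 * L * (2 ^ (K - k) / 16)" by simp
        also have "\<dots> \<le> \<epsilon>\<^sup>2 * real t * (2 ^ (K - k) / 16)"
          using epst by (intro mult_right_mono) auto
        finally show ?thesis by simp
      qed
      ultimately have "2 ^ (K - k) * (3/4 * L) \<le> \<epsilon>\<^sup>2 * (F * (1/2) ^ k) / 4" by linarith
      moreover have "real (Suc K - k) * ln (1 / x) \<le> 2 ^ (K - k) * (3/4 * L)"
      proof (intro mult_mono lnL)
        \<comment> \<open>j + 1 \<le> 2^j replaces doubly exponential decay by geometric decay,
          which is easy to sum.\<close>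
        have "Suc (K - k) \<le> 2 ^ (K - k)" by (simp add: Suc_le_eq)
        then show "real (Suc K - k) \<le> 2 ^ (K - k)"
          using k by (metis Suc_diff_le of_nat_le_iff of_nat_numeral of_nat_power)
      qed (use x in auto)
      ultimately have "real (Suc K - k) * ln (1 / x) \<le> \<epsilon>\<^sup>2 * (F * (1/2) ^ k) / 4" by linarith
      then show ?thesis by simp
    qed
    also have "exp (- (real (Suc K - k) * ln (1 / x))) = x ^ (Suc K - k)"
      using x by (simp add: ln_div exp_of_nat_mult)
    finally show ?thesis .
  qed
  have "(\<Sum>k=0..K. measure_pmf.prob (ideal k {} 0 A) {Y. real (card Y) * 2 ^ k \<notin> G})
     = (\<Sum>k=1..K. measure_pmf.prob (ideal k {} 0 A) {Y. real (card Y) * 2 ^ k \<notin> G})"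
  proof -
    \<comment> \<open>At level 0 the ideal sample is the full set of distinct elements, so the
      estimate equals \<open>F\<close>.\<close>
    have "{Y. real (card Y) * 2 ^ 0 \<notin> G} \<inter> {set A} = {}"
      using eps by (auto simp: G_def F_def F0_def mult_left_le_one_le mult_right_mono algebra_simps)
    then have "measure_pmf.prob (ideal 0 {} 0 A) {Y. real (card Y) * 2 ^ 0 \<notin> G} = 0"
      by (simp add: ideal_empty measure_return indicator_def)
    then show ?thesis by (simp add: sum.atLeast_Suc_atMost)
  qed
  also have "\<dots> \<le> (\<Sum>k=1..K. 2 * x ^ (Suc K - k))" by (intro sum_mono dev) auto
  also have "\<dots> = 2 * x * (\<Sum>i<K. x ^ i)"
    by (subst sum.atLeastAtMost_rev)
       (simp add: sum_distrib_left sum.atLeast1_atMost_eq mult_ac)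
  also have "\<dots> \<le> 2 * x * (3/2)"
  proof (intro mult_left_mono)
    have "(\<Sum>i<K. x ^ i) = (1 - x ^ K) / (1 - x)" using x by (simp add: sum_gp_strict)
    also have "\<dots> \<le> 1 / (1 - x)" using x by (intro divide_right_mono) auto
    also have "\<dots> \<le> 3/2" using x by (simp add: field_simps)
    finally show "(\<Sum>i<K. x ^ i) \<le> 3/2" .
  qed (use x in auto)
  finally have dev_sum: "(\<Sum>k=0..K. measure_pmf.prob (ideal k {} 0 A) {Y. real (card Y) * 2 ^ k \<notin> G}) \<le> 3 * x"
    by simp
  have "emeasure (F0_loop t A {} 1 V) {r. fst r \<notin> Some ` G} \<le> failure_bound t K G {} 0 A"
    using loop_failure[of "{}" 0 K t A V G] t0 by simp
  also have "\<dots> = ennreal (real m * (1/2) ^ t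
      + (\<Sum>j<m. measure_pmf.prob (ideal K {} 0 (take (Suc j) A)) {Y. card Y = t})
      + (\<Sum>k=0..K. measure_pmf.prob (ideal k {} 0 A) {Y. real (card Y) * 2 ^ k \<notin> G}))"
    unfolding failure_bound_def m_def
    by (simp add: measure_pmf.emeasure_eq_measure ennreal_of_nat_eq_real_of_nat
        ennreal_mult'[symmetric] sum_nonneg)
  also have "\<dots> \<le> ennreal \<delta>"
  proof (intro ennreal_leI)
    \<comment> \<open>As 1 \<le> m, the three contributions add up to at most 5mx, while 8mx =
      \<delta>.\<close>
    have "(\<Sum>j<m. measure_pmf.prob (ideal K {} 0 (take (Suc j) A)) {Y. card Y = t}) \<le> real m * x"
      using sum_mono[of "{..<m}", OF reach] by simp
    moreover have "real m * (1/2) ^ t \<le> real m * x" using half_t by (intro mult_left_mono) auto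
    moreover have "1 * x \<le> real m * x" using m x by (intro mult_right_mono) auto
    moreover have "8 * (real m * x) = \<delta>" using m by (simp add: x_def)
    ultimately show "real m * (1/2) ^ t
      + (\<Sum>j<m. measure_pmf.prob (ideal K {} 0 (take (Suc j) A)) {Y. card Y = t})
      + (\<Sum>k=0..K. measure_pmf.prob (ideal k {} 0 A) {Y. real (card Y) * 2 ^ k \<notin> G}) \<le> \<delta>"
      using dev_sum delta by linarith
  qed
  finally show ?thesis by (simp add: G_def)
qed

lemma F0_Estimator_approximation:
  assumes "0 < \<epsilon>" "\<epsilon> < 1" "0 < \<delta>" "\<delta> < 1"
  shows "is_approximation \<epsilon> \<delta> (F0_Estimator A \<epsilon> \<delta>) (real (F0 A))"
proof (cases "A = []")
  \<comment> \<open>The empty stream yields the exact output 0; it is separate because \<delta>/(8m)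
    calls for m > 0.\<close>
  case True
  then show ?thesis
    using assms by (auto simp: is_approximation_def F0_Estimator_def F0_execution_def F0_def measure_return
        indicator_def)
next
  case False
  let ?D = "F0_execution A \<epsilon> \<delta>"
  let ?G = "{(1 - \<epsilon>) * real (F0 A)..(1 + \<epsilon>) * real (F0 A)}"
  have "emeasure ?D {r. fst r \<notin> Some ` ?G} \<le> ennreal \<delta>"
    unfolding F0_execution_def by (rule F0_estimate_failure[OF False assms])
  then have "measure_pmf.prob ?D {r. fst r \<notin> Some ` ?G} \<le> \<delta>"
    using assms(3) by (simp add: measure_pmf.emeasure_eq_measure)
  moreover have "measure_pmf.prob ?D {r. fst r \<in> Some ` ?G} = 1 - measure_pmf.prob ?D {r. fst r \<notin> Some ` ?G}"
    by (subst measure_pmf.prob_compl[symmetric]) (auto intro!: arg_cong[where f = "measure _"])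
  moreover have "{Some c | c. (1 - \<epsilon>) * real (F0 A) \<le> c \<and> c \<le> (1 + \<epsilon>) * real (F0 A)} = Some ` ?G"
    by auto
  ultimately show ?thesis
    by (simp add: is_approximation_def F0_Estimator_def vimage_def)
qed

section \<open>Memory contents and worst-case space\<close>

text \<open>Each iteration starts below the threshold and adds at most one element, so
  \<open>t\<close> is never exceeded. A halving either leads below \<open>t\<close> again or halts,
  and the level rises at most once per stream element.\<close>

lemma F0_loop_memory:
  assumes "finite X" "card X < t" "(c, V') \<in> set_pmf (F0_loop t as X ((1/2) ^ l) V)"
  shows "V' \<subseteq> V \<union> {(Y, (1/2) ^ k) | Y k. card Y \<le> t \<and> k \<le> l + length as}"
  using assms
proof (induction as arbitrary: X l V)
  case Nil
  then show ?case by auto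
next
  case (Cons a as)
  let ?S = "{(Y, (1/2::real) ^ k) | Y k. card (Y :: nat set) \<le> t \<and> k \<le> l + length (a # as)}"
  have mem: "(Y, (1/2) ^ k) \<in> ?S" if "card Y \<le> t" "k \<le> Suc l" for Y k
    using that by auto
  from Cons.prems(3) obtain Y where Y: "Y \<in> set_pmf (refresh ((1/2) ^ l) X a)"
    and run: "(c, V') \<in> set_pmf (let V2 = V \<union> {(X - {a}, (1/2) ^ l), (Y, (1/2) ^ l)} in
     if card Y = t then
       bind_pmf (subsample (1/2) Y) (\<lambda>X3.
         let V3 = V2 \<union> {(X3, (1/2) ^ l / 2)} in
         if card X3 = t then return_pmf (None, V3) else F0_loop t as X3 ((1/2) ^ l / 2) V3)
     else F0_loop t as Y ((1/2) ^ l) V2)"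
    unfolding F0_loop_Cons by (auto simp only: set_bind_pmf)
  let ?V2 = "V \<union> {(X - {a}, (1/2) ^ l), (Y, (1/2) ^ l)}"
  have "finite Y" using set_pmf_refresh[OF Y] Cons.prems(1) finite_subset by blast
  have "card (X - {a}) < t"
    using Cons.prems(1,2) card_mono[of X "X - {a}"] by auto
  moreover have "card Y \<le> Suc (card (X - {a}))"
    using Y Cons.prems(1) by (auto simp: refresh_def card_insert_if split: if_splits)
  ultimately have card_Y: "card Y \<le> t" by simp
  have V2: "?V2 \<subseteq> V \<union> ?S"
    using mem \<open>card (X - {a}) < t\<close> card_Y by auto
  show ?case
  proof (cases "card Y = t")
    case False
    then have "V' \<subseteq> ?V2 \<union> {(Y, (1/2) ^ k) | Y k. card Y \<le> t \<and> k \<le> l + length as}"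
      using Cons.IH[of Y l ?V2] \<open>finite Y\<close> card_Y run by (simp add: Let_def)
    with V2 show ?thesis by fastforce
  next
    case True
    with run obtain Z where Z: "Z \<in> set_pmf (subsample (1/2) Y)"
      and run': "(c, V') \<in> set_pmf (if card Z = t then return_pmf (None, ?V2 \<union> {(Z, (1/2) ^ l / 2)})
         else F0_loop t as Z ((1/2) ^ l / 2) (?V2 \<union> {(Z, (1/2) ^ l / 2)}))"
      unfolding Let_def if_P[OF True] set_bind_pmf by blast
    have "Z \<subseteq> Y" using Z by (rule set_pmf_subsample)
    then have Z: "finite Z" "card Z \<le> t"
      using \<open>finite Y\<close> card_Y by (auto intro: finite_subset order_trans[OF card_mono])
    have V3: "?V2 \<union> {(Z, (1/2) ^ l / 2)} \<subseteq> V \<union> ?S"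
      using V2 mem[of Z "Suc l"] Z by auto
    show ?thesis
    proof (cases "card Z = t")
      case True
      with run' V3 show ?thesis by auto
    next
      case False
      then have "V' \<subseteq> ?V2 \<union> {(Z, (1/2) ^ l / 2)}
          \<union> {(Y, (1/2) ^ k) | Y k. card Y \<le> t \<and> k \<le> Suc l + length as}"
        using Cons.IH[of Z "Suc l" "?V2 \<union> {(Z, (1/2) ^ l / 2)}"] Z run' by simp
      also have "\<dots> \<subseteq> V \<union> ?S" using V3 by auto
      finally show ?thesis .
    qed
  qed
qed

text \<open>As m/\<delta> \<ge> 2, its logarithm L is at least 1. Hence 12(3 + L) \<le> 48L, and the
  1 lost by rounding up is at most L/\<epsilon>^2, which gives 49.\<close>

lemma F0_thresh_le:
  fixes \<epsilon> \<delta> :: real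
  assumes "0 < \<epsilon>" "\<epsilon> < 1" "0 < \<delta>" "2 \<le> real m / \<delta>"
  shows "real (F0_thresh m \<epsilon> \<delta>) \<le> 49 * (log 2 (real m / \<delta>) / \<epsilon>\<^sup>2)"
proof -
  let ?L = "log 2 (real m / \<delta>)"
  have m: "0 < real m / \<delta>" using assms by linarith
  have L: "1 \<le> ?L" using assms m by (simp add: le_log_iff)
  have log8: "log 2 (8 * real m / \<delta>) = 3 + ?L"
  proof -
    have "log 2 (8 * (real m / \<delta>)) = log 2 (2 ^ 3) + ?L"
      using m by (subst log_mult) auto
    then show ?thesis using log_pow_cancel[of "2::real" 3] by simp
  qed
  have "\<epsilon>\<^sup>2 \<le> 1" using assms by (simp add: power_le_one)
  then have "\<epsilon>\<^sup>2 \<le> ?L" using L by linarith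
  then have "1 \<le> ?L / \<epsilon>\<^sup>2" using assms by (simp add: le_divide_eq)
  moreover have "real (F0_thresh m \<epsilon> \<delta>) \<le> 12 / \<epsilon>\<^sup>2 * (3 + ?L) + 1"
  proof -
    have "0 \<le> 12 / \<epsilon>\<^sup>2 * (3 + ?L)" using L by simp
    then show ?thesis unfolding F0_thresh_def log8 by linarith
  qed
  moreover have "12 / \<epsilon>\<^sup>2 * (3 + ?L) \<le> 12 / \<epsilon>\<^sup>2 * (4 * ?L)"
    using L assms by (intro mult_left_mono) auto
  ultimately show ?thesis by simp
qed

lemma floorlog_le_log:
  assumes "0 < m"
  shows "real (floorlog 2 m) \<le> log 2 (real m) + 1"
  using assms by (simp add: floorlog_def)

lemma floorlog_le_self: "floorlog 2 k \<le> k"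
  using floorlog_le_iff[of 2 k k] by (simp add: floorlog_leD)

text \<open>With \<open>W\<close> and \<open>?D\<close> at least 1, the lower-order terms are
  absorbed into \<open>W * ?D\<close>: 100 for the stored elements, 49 for the threshold and 2 each
  for the level and the loop index.\<close>

lemma F0_Estimator_space:
  assumes "0 < \<epsilon>" "\<epsilon> < 1" "0 < \<delta>" "\<delta> < 1" and n: "2 \<le> n" and m: "2 \<le> real (length A) / \<delta>"
  shows "worst_case_space_le n A \<epsilon> \<delta>
    (200 * (1 / \<epsilon>\<^sup>2 * log 2 (real n) * (log 2 (real (length A)) + log 2 (1 / \<delta>))))"
proof -
  let ?m = "length A" and ?D = "log 2 (real n)"
  define t where "t = F0_thresh ?m \<epsilon> \<delta>"
  define W where "W = log 2 (real ?m / \<delta>) / \<epsilon>\<^sup>2"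
  have m0: "0 < ?m" using m by (cases A) auto
  have L1: "1 \<le> log 2 (real ?m / \<delta>)" using m m0 assms by (simp add: le_log_iff)
  have "\<epsilon>\<^sup>2 \<le> 1" using assms by (simp add: power_le_one)
  then have LW: "log 2 (real ?m / \<delta>) \<le> W"
    unfolding W_def using L1 assms mult_left_mono[of "\<epsilon>\<^sup>2" 1 "log 2 (real ?m / \<delta>)"]
    by (simp add: field_simps)
  then have W: "1 \<le> W" using L1 by simp
  have Lsum: "log 2 (real ?m / \<delta>) = log 2 (real ?m) + log 2 (1 / \<delta>)"
    using m0 assms by (simp add: log_divide)
  have D: "1 \<le> ?D" using n by (simp add: le_log_iff)
  have WD: "W \<le> W * ?D" using mult_left_mono[OF D, of W] W by simp
  have t_le: "real t \<le> 49 * W"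
    unfolding t_def W_def using assms by (intro F0_thresh_le) auto
  have logm: "real (floorlog 2 ?m) \<le> 2 * W"
  proof -
    have "0 \<le> log 2 (1 / \<delta>)" using assms by simp
    then have "log 2 (real ?m) \<le> W" using LW Lsum by linarith
    then show ?thesis using floorlog_le_log[OF m0] W by linarith
  qed
  have "0 < t"
  proof -
    have "0 < log 2 (8 * real ?m / \<delta>)" using m m0 assms by (simp add: field_simps)
    then show ?thesis unfolding t_def F0_thresh_def using assms by simp
  qed
  have bits: "real (space_bits n ?m t X p) \<le> 200 * (W * ?D)"
    if X: "card X \<le> t" and p: "p = (1/2) ^ k" "k \<le> ?m" for X p k
  proof -
    have "log 2 (1 / p) = real k" by (simp add: p power_one_over log_nat_power)
    then have "floorlog 2 (nat \<lfloor>log 2 (1 / p)\<rfloor>) \<le> floorlog 2 ?m" using p by (simp add: floorlog_mono)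
    then have "real (floorlog 2 (nat \<lfloor>log 2 (1 / p)\<rfloor>)) \<le> 2 * W" using logm by simp
    \<comment> \<open>The crude bound of a binary length by the number itself suffices, as
      \<open>t\<close> is already of order \<open>W\<close>.\<close>
    moreover have "real (floorlog 2 t) \<le> 49 * W"
      using floorlog_le_self[of t] t_le by simp
    moreover have "real ((card X + 1) * nat \<lceil>?D\<rceil>) \<le> (50 * W) * (2 * ?D)"
      unfolding of_nat_mult
    proof (intro mult_mono)
      show "real (card X + 1) \<le> 50 * W" using X t_le W by simp
      have "real (nat \<lceil>?D\<rceil>) \<le> ?D + 1" using D by linarith
      then show "real (nat \<lceil>?D\<rceil>) \<le> 2 * ?D" using D by linarith
    qed (use W in auto)
    ultimately show ?thesis
      unfolding space_bits_def of_nat_add using logm WD by linarith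
  qed
  have "real (space_bits n ?m t X p) \<le> 200 * (W * ?D)"
    if "(c, V) \<in> set_pmf (F0_execution A \<epsilon> \<delta>)" "(X, p) \<in> V" for c V X p
  proof -
    have "(c, V) \<in> set_pmf (F0_loop t A {} ((1/2) ^ 0) {({}, 1)})"
      using that(1) by (simp add: F0_execution_def t_def)
    from F0_loop_memory[OF _ _ this] that(2) \<open>0 < t\<close>
    have "(X, p) = ({}, 1) \<or> (\<exists>k. card X \<le> t \<and> p = (1/2) ^ k \<and> k \<le> ?m)" by auto
    \<comment> \<open>The initial memory content is the case k = 0.\<close>
    then obtain k where "card X \<le> t" "p = (1/2) ^ k" "k \<le> ?m"
      by (metis Pair_inject card.empty le0 power_0)
    then show ?thesis by (rule bits)
  qed
  then show ?thesis
    unfolding worst_case_space_le_def t_def[symmetric] Lsum[symmetric]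
    by (auto simp: W_def mult_ac)
qed

theorem theorem1:
  shows "(\<forall>(n::nat) (A::nat list) (\<epsilon>::real) (\<delta>::real).
            set A \<subseteq> {1..n} \<and> 0 < \<epsilon> \<and> \<epsilon> < 1 \<and> 0 < \<delta> \<and> \<delta> < 1 \<longrightarrow>
            is_approximation \<epsilon> \<delta> (F0_Estimator A \<epsilon> \<delta>) (real (F0 A)))
       \<and> (\<exists>C>0. \<forall>(n::nat) (A::nat list) (\<epsilon>::real) (\<delta>::real).
            set A \<subseteq> {1..n} \<and> 0 < \<epsilon> \<and> \<epsilon> < 1 \<and> 0 < \<delta> \<and> \<delta> < 1 \<and>
            n \<ge> 2 \<and> real (length A) / \<delta> \<ge> 2 \<longrightarrow>
            worst_case_space_le n A \<epsilon> \<delta>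
              (C * (1 / \<epsilon>\<^sup>2 * log 2 (real n) * (log 2 (real (length A)) + log 2 (1 / \<delta>)))))"
proof (intro conjI allI impI)
  show "\<exists>C>0. \<forall>(n::nat) (A::nat list) (\<epsilon>::real) (\<delta>::real).
            set A \<subseteq> {1..n} \<and> 0 < \<epsilon> \<and> \<epsilon> < 1 \<and> 0 < \<delta> \<and> \<delta> < 1 \<and>
            n \<ge> 2 \<and> real (length A) / \<delta> \<ge> 2 \<longrightarrow>
            worst_case_space_le n A \<epsilon> \<delta>
              (C * (1 / \<epsilon>\<^sup>2 * log 2 (real n) * (log 2 (real (length A)) + log 2 (1 / \<delta>))))"
    by (rule exI[of _ 200]) (intro conjI allI impI F0_Estimator_space; simp)
qed (intro F0_Estimator_approximation; blast)

end
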